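(* Let $d\ge2$ and let $\mathcal A\in\mathbb C^{n_1\times n_2\times\cdots\times n_d}$ with $\|\mathcal A\|_{\mathrm F}=1$. Put $r_0=r_d=1$ and $r_k=\mathrm{rank}(\mathbf A_{\langle k\rangle})$ for $k=1,\dots,d-1$. Then $\mathcal A$ admits an exact normalized tensor train decomposition: there exist core tensors $\mathcal U_k\in\mathbb C^{r_{k-1}\times n_k\times r_k}$, $k=1,\dots,d$, such that $$\mathcal A=[\![\mathcal U_1,\mathcal U_2,\dots,\mathcal U_d]\!]\quad\text{and}\quad\big\|[\![\mathcal U_1,\mathcal U_2,\dots,\mathcal U_d]\!]\big\|_{\mathrm F}=1.$$
   Context: $\mathbf A_{\langle k\rangle}\in\mathbb C^{(n_1\cdots n_k)\times(n_{k+1}\cdots n_d)}$ is the $k$-th unfolding of $\mathcal A$, with rows indexed by $(i_1,\dots,i_k)$ and columns by $(i_{k+1},\dots,i_d)$. $[\![\mathcal U_1,\dots,\mathcal U_d]\!]$ is the tensor with entries $\mathbf U_1(i_1)\mathbf U_2(i_2)\cdots\mathbf U_d(i_d)$, where $\mathbf U_k(i_k)=\mathcal U_k(:,i_k,:)\in\mathbb C^{r_{k-1}\times r_k}$. $\|\cdot\|_{\mathrm F}$ is the Frobenius norm (square root of the sum of squared moduli of the entries). *)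

theory Defs
  imports Complex_Main "Jordan_Normal_Form.DL_Rank"
begin

(* A multi-index is a list; positions and index values count from 0, so that the
   (one-based) index i_k of mode k is is ! (k - 1), with values 0, ..., n_k - 1. *)

definition multi_indices :: "nat list \<Rightarrow> nat list set" where
  "multi_indices ns = {is. length is = length ns \<and> (\<forall>k < length ns. is ! k < ns ! k)}"

(* The space of complex tensors of shape ns.  Entries outside the index range are 0, so that
   equality of functions is equality of tensors. *)

definition tensors :: "nat list \<Rightarrow> (nat list \<Rightarrow> complex) set" where
  "tensors ns = {A. \<forall>is. is \<notin> multi_indices ns \<longrightarrow> A is = 0}"

definition frobenius_norm :: "nat list \<Rightarrow> (nat list \<Rightarrow> complex) \<Rightarrow> real" where
  "frobenius_norm ns A = sqrt (\<Sum>is\<in>multi_indices ns. (cmod (A is))\<^sup>2)"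

(* The rows and columns of an unfolding are labelled by multi-indices; matrices are indexed by
   numbers, so multi-indices are enumerated in lexicographic order.  The order only permutes
   the rows and columns. *)

definition multi_index_list :: "nat list \<Rightarrow> nat list list" where
  "multi_index_list ns = product_lists (map (\<lambda>n. [0..<n]) ns)"

lemma set_multi_index_list: "set (multi_index_list ns) = multi_indices ns"
  by (auto simp: multi_index_list_def multi_indices_def product_lists_set list_all2_conv_all_nth)

lemma distinct_multi_index_list: "distinct (multi_index_list ns)"
  unfolding multi_index_list_def by (rule distinct_product_lists) auto

lemma length_multi_index_list: "length (multi_index_list ns) = prod_list ns"
  unfolding multi_index_list_def
  by (induction ns) (simp_all add: length_concat o_def sum_list_triv)

definition unfolding_mat :: "nat list \<Rightarrow> nat \<Rightarrow> (nat list \<Rightarrow> complex) \<Rightarrow> complex mat" where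
  "unfolding_mat ns k A =
     mat (prod_list (take k ns)) (prod_list (drop k ns))
       (\<lambda>(a, b). A (multi_index_list (take k ns) ! a @ multi_index_list (drop k ns) ! b))"

definition mat_rank :: "complex mat \<Rightarrow> nat" where
  "mat_rank M = vec_space.rank (dim_row M) M"

definition core_slice :: "nat \<Rightarrow> nat \<Rightarrow> (nat list \<Rightarrow> complex) \<Rightarrow> nat \<Rightarrow> complex mat" where
  "core_slice p q G i = mat p q (\<lambda>(a, b). G [a, i, b])"

(* The tensor with cores U 1, ..., U d, where d = length ns and U k has shape
   r (k - 1) x n_k x r k.  It is meant for r 0 = r d = 1, when the matrix product is 1 x 1;
   the trailing factor 1_m (r d) is then the 1 x 1 identity. *)

definition tt_tensor ::
  "nat list \<Rightarrow> (nat \<Rightarrow> nat) \<Rightarrow> (nat \<Rightarrow> nat list \<Rightarrow> complex) \<Rightarrow> nat list \<Rightarrow> complex" where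
  "tt_tensor ns r U is =
     (if is \<in> multi_indices ns
      then foldr (*) (map (\<lambda>k. core_slice (r (k - 1)) (r k) (U k) (is ! (k - 1)))
                          [1..<Suc (length ns)])
             (1\<^sub>m (r (length ns))) $$ (0, 0)
      else 0)"

end

theory Submission
  imports Defs
begin

text \<open>
  The norm plays two parts only: it makes \<open>A\<close> nonzero, and it passes to the train once the train
  represents \<open>A\<close> exactly.  The content is the exact representation with the bond dimensions
  \<open>r k\<close>.

  Cutting \<open>A\<close> after position \<open>k\<close> gives a factorization
  \<open>A (i @ j) = (\<Sum>a<r k. B k i a * C k a j)\<close>, in which the functions \<open>B k _ a\<close> of the prefix are
  themselves combinations of columns, \<open>B k i a = (\<Sum>j. A (i @ j) * D k j a)\<close>: take as \<open>B k _ a\<close>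
  a maximal independent family of columns of the unfolding (\<open>unfolding_factors\<close>).  This second
  property makes consecutive cuts compatible.  If the column combination that produces \<open>B k\<close> is
  evaluated on a prefix \<open>i @ [x]\<close>, and \<open>A\<close> is expanded along the cut at \<open>k - 1\<close>, the outcome is
  \<open>B k (i @ [x]) b = (\<Sum>a. B (k - 1) i a * U k [a, x, b])\<close> with a core \<open>U k\<close> that does not depend
  on \<open>i\<close> (\<open>factors_extend_prefix\<close>).  So multiplying by the next core slice carries the row vector
  of one cut to that of the next (\<open>row_times_matrix_chain\<close>).  At the trivial cuts one takes
  \<open>B 0 [] 0 = 1\<close> and \<open>B d i 0 = A i\<close>, and the whole product equals \<open>A i\<close>.
\<close>

section \<open>Factoring a matrix through its rank\<close>

text \<open>
  A maximal independent set of columns has \<open>rank M\<close> elements and spans all columns.  Later it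
  matters that the left factor consists of columns of \<open>M\<close>, hence the column positions \<open>J\<close>.
\<close>

lemma (in vec_space) rank_column_factorization:
  assumes M: "M \<in> carrier_mat n nc"
  shows "\<exists>J C. (\<forall>a<rank M. J a < nc) \<and>
           (\<forall>i<n. \<forall>j<nc. M $$ (i, j) = (\<Sum>a<rank M. M $$ (i, J a) * C a j))"
proof -
  let ?P = "\<lambda>T. T \<subseteq> set (cols M) \<and> lin_indpt T"
  have cols: "set (cols M) \<subseteq> carrier_vec n"
    using cols_dim M by blast
  have "lin_indpt {}"
    by (simp add: lin_dep_def)
  then obtain S where fin: "finite S" and max: "maximal S ?P"
    using maximal_exists_superset[of "set (cols M)" ?P "{}"] by auto
  have S: "S \<subseteq> set (cols M)" and indpt: "lin_indpt S"
    using max by (auto simp: maximal_def)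
  have rank: "rank M = card S"
    by (rule rank_card_indpt[OF M max])
  have in_span: "v \<in> span S" if v: "v \<in> set (cols M)" for v
  proof (rule ccontr)
    assume notin: "v \<notin> span S"
    have "v \<notin> S"
      using notin S cols span_mem[of S v] by auto
    moreover have "lin_indpt (S \<union> {v})"
      using lin_dep_iff_in_span[of S v] S cols indpt notin v \<open>v \<notin> S\<close> by auto
    ultimately show False
      using max S v unfolding maximal_def by blast
  qed
  obtain s where s: "bij_betw s {..<card S} S"
    using ex_bij_betw_nat_finite[OF fin] by (auto simp: atLeast0LessThan)
  have "\<exists>j<nc. col M j = s a" if "a < card S" for a
  proof -
    have "s a \<in> set (cols M)"
      using bij_betwE[OF s] that S by auto
    then show ?thesis
      using M by (auto simp: in_set_conv_nth)
  qed
  then obtain J where J: "\<And>a. a < card S \<Longrightarrow> J a < nc \<and> col M (J a) = s a"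
    by metis
  have "\<exists>c. \<forall>i<n. M $$ (i, j) = (\<Sum>a<card S. M $$ (i, J a) * c a)" if j: "j < nc" for j
  proof -
    have "col M j \<in> set (cols M)"
      using j M by (auto simp: cols_def)
    then have "col M j \<in> span S"
      by (rule in_span)
    then obtain c where c: "col M j = lincomb c S"
      using finite_span[OF fin] S cols by auto
    have "M $$ (i, j) = (\<Sum>a<card S. M $$ (i, J a) * c (s a))" if i: "i < n" for i
    proof -
      have "M $$ (i, j) = lincomb c S $ i"
        using c[symmetric] i j M by simp
      also have "\<dots> = (\<Sum>x\<in>S. c x * x $ i)"
        using S cols by (intro lincomb_index[OF i]) auto
      also have "\<dots> = (\<Sum>a<card S. c (s a) * s a $ i)"
        by (rule sum.reindex_bij_betw[OF s, symmetric])
      also have "\<dots> = (\<Sum>a<card S. M $$ (i, J a) * c (s a))"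
      proof (rule sum.cong[OF refl])
        fix a assume "a \<in> {..<card S}"
        then have "s a $ i = M $$ (i, J a)"
          using J[of a] i M by (metis carrier_matD index_col lessThan_iff)
        then show "c (s a) * s a $ i = M $$ (i, J a) * c (s a)"
          by simp
      qed
      finally show ?thesis .
    qed
    then show ?thesis
      by (intro exI[of _ "\<lambda>a. c (s a)"]) simp
  qed
  then obtain C where "\<And>j i. j < nc \<Longrightarrow> i < n \<Longrightarrow>
      M $$ (i, j) = (\<Sum>a<card S. M $$ (i, J a) * C j a)"
    by metis
  then show ?thesis
    using J unfolding rank by (intro exI[of _ J] exI[of _ "\<lambda>a j. C j a"] conjI) blast+
qed

section \<open>Factoring a tensor at a cut\<close>

lemma finite_multi_indices: "finite (multi_indices ns)"
  by (metis set_multi_index_list List.finite_set)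

lemma multi_index_list_position:
  assumes "is \<in> multi_indices ns"
  obtains p where "p < prod_list ns" "multi_index_list ns ! p = is"
  using assms by (metis in_set_conv_nth length_multi_index_list set_multi_index_list)

lemma take_mem_multi_indices:
  "is \<in> multi_indices ns \<Longrightarrow> take k is \<in> multi_indices (take k ns)"
  by (auto simp: multi_indices_def)

lemma Cons_mem_multi_indices_drop:
  assumes "k < length ns" "x < ns ! k" "j \<in> multi_indices (drop (Suc k) ns)"
  shows "x # j \<in> multi_indices (drop k ns)"
proof -
  have "drop k ns = ns ! k # drop (Suc k) ns"
    using assms(1) by (simp add: Cons_nth_drop_Suc)
  then show ?thesis
    using assms(2,3) by (simp add: multi_indices_def All_less_Suc2 del: nth_drop)
qed

text \<open>
  A factorization of the \<open>k\<close>-th unfolding of \<open>A\<close> through dimension \<open>p\<close>, labelled by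
  multi-indices.  The third factor \<open>D\<close> records that the columns of \<open>B\<close> lie in the column
  space of the unfolding.
\<close>

definition cut_factors ::
  "nat list \<Rightarrow> (nat list \<Rightarrow> complex) \<Rightarrow> nat \<Rightarrow> nat \<Rightarrow> (nat list \<Rightarrow> nat \<Rightarrow> complex) \<Rightarrow>
   (nat \<Rightarrow> nat list \<Rightarrow> complex) \<Rightarrow> (nat list \<Rightarrow> nat \<Rightarrow> complex) \<Rightarrow> bool" where
  "cut_factors ns A k p B C D \<longleftrightarrow>
     (\<forall>i\<in>multi_indices (take k ns).
        (\<forall>j\<in>multi_indices (drop k ns). A (i @ j) = (\<Sum>a<p. B i a * C a j)) \<and>
        (\<forall>a<p. B i a = (\<Sum>j\<in>multi_indices (drop k ns). A (i @ j) * D j a)))"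

lemma cut_factors_entry:
  assumes "cut_factors ns A k p B C D"
    and "i \<in> multi_indices (take k ns)" "j \<in> multi_indices (drop k ns)"
  shows "A (i @ j) = (\<Sum>a<p. B i a * C a j)"
  using assms unfolding cut_factors_def by blast

lemma cut_factors_column:
  assumes "cut_factors ns A k p B C D"
    and "i \<in> multi_indices (take k ns)" "a < p"
  shows "B i a = (\<Sum>j\<in>multi_indices (drop k ns). A (i @ j) * D j a)"
  using assms unfolding cut_factors_def by blast

lemma unfolding_factors:
  "\<exists>B C D. cut_factors ns A k (mat_rank (unfolding_mat ns k A)) B C D"
proof -
  let ?M = "unfolding_mat ns k A"
  let ?r = "mat_rank ?M"
  let ?m = "prod_list (take k ns)" and ?n = "prod_list (drop k ns)"
  let ?I = "multi_index_list (take k ns)" and ?J = "multi_index_list (drop k ns)"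
  have M: "?M \<in> carrier_mat ?m ?n"
    by (simp add: unfolding_mat_def)
  obtain J C where J: "\<And>a. a < ?r \<Longrightarrow> J a < ?n"
    and C: "\<And>i j. i < ?m \<Longrightarrow> j < ?n \<Longrightarrow> ?M $$ (i, j) = (\<Sum>a<?r. ?M $$ (i, J a) * C a j)"
    using vec_space.rank_column_factorization[OF M]
    unfolding mat_rank_def carrier_matD(1)[OF M] by blast
  have "\<exists>q<?n. ?J ! q = j" if "j \<in> multi_indices (drop k ns)" for j
    using multi_index_list_position[OF that] by blast
  then obtain pos where pos: "\<And>j. j \<in> multi_indices (drop k ns) \<Longrightarrow> pos j < ?n \<and> ?J ! pos j = j"
    by metis
  have entry: "?M $$ (p, q) = A (?I ! p @ ?J ! q)" if "p < ?m" "q < ?n" for p q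
    using that by (simp add: unfolding_mat_def)
  have J_mem: "?J ! J a \<in> multi_indices (drop k ns)" if "a < ?r" for a
    using J[OF that] by (metis length_multi_index_list nth_mem set_multi_index_list)
  have "A (i @ j) = (\<Sum>a<?r. A (i @ ?J ! J a) * C a (pos j))"
    if i: "i \<in> multi_indices (take k ns)" and j: "j \<in> multi_indices (drop k ns)" for i j
  proof -
    obtain p where p: "p < ?m" "?I ! p = i"
      using multi_index_list_position[OF i] by blast
    have "?M $$ (p, pos j) = (\<Sum>a<?r. ?M $$ (p, J a) * C a (pos j))"
      using C[OF p(1)] pos[OF j] by blast
    then show ?thesis
      using pos[OF j] p J by (simp add: entry)
  qed
  moreover have "A (i @ ?J ! J a) =
      (\<Sum>j\<in>multi_indices (drop k ns). A (i @ j) * (if j = ?J ! J a then 1 else 0))"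
    if "a < ?r" for i a
    using J_mem[OF that] by (simp add: finite_multi_indices if_distrib cong: if_cong)
  ultimately have "cut_factors ns A k ?r (\<lambda>i a. A (i @ ?J ! J a)) (\<lambda>a j. C a (pos j))
      (\<lambda>j a. if j = ?J ! J a then 1 else 0)"
    unfolding cut_factors_def by blast
  then show ?thesis
    by blast
qed

text \<open>
  At the cut before the first position, the constant \<open>1\<close> must be a combination of entries of
  \<open>A\<close>; the conjugate entries are coefficients for it, because \<open>A\<close> has norm one.
\<close>

lemma cut_factors_first:
  assumes "frobenius_norm ns A = 1"
  shows "cut_factors ns A 0 1 (\<lambda>i a. 1) (\<lambda>a. A) (\<lambda>j a. cnj (A j))"
proof -
  have "(\<Sum>j\<in>multi_indices ns. (cmod (A j))\<^sup>2) = 1"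
    using assms by (simp add: frobenius_norm_def)
  moreover have "(\<Sum>j\<in>multi_indices ns. A j * cnj (A j)) =
      of_real (\<Sum>j\<in>multi_indices ns. (cmod (A j))\<^sup>2)"
    by (simp only: of_real_sum complex_norm_square)
  ultimately show ?thesis
    by (auto simp: cut_factors_def multi_indices_def)
qed

lemma cut_factors_last:
  "cut_factors ns A (length ns) 1 (\<lambda>i a. A i) (\<lambda>a j. 1) (\<lambda>j a. 1)"
  by (simp add: cut_factors_def multi_indices_def)

section \<open>Cores between neighbouring cuts\<close>

text \<open>
  Both sides compute \<open>\<Sum>j. A (i @ x # j) * D' j b\<close>: the column combination that gives \<open>B'\<close>
  splits \<open>i @ x # j\<close> after \<open>x\<close>, while the expansion through \<open>B\<close> and \<open>C\<close> splits it before \<open>x\<close>.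
\<close>

lemma factors_extend_prefix:
  assumes cut: "cut_factors ns A k p B C D" and cut': "cut_factors ns A (Suc k) q B' C' D'"
    and k: "k < length ns" and i: "i \<in> multi_indices (take k ns)" and x: "x < ns ! k"
    and b: "b < q"
  shows "B' (i @ [x]) b =
    (\<Sum>a<p. B i a * (\<Sum>j\<in>multi_indices (drop (Suc k) ns). C a (x # j) * D' j b))"
proof -
  let ?J = "multi_indices (drop (Suc k) ns)"
  have "i @ [x] \<in> multi_indices (take (Suc k) ns)"
    using i x k by (auto simp: multi_indices_def nth_append less_Suc_eq)
  then have "B' (i @ [x]) b = (\<Sum>j\<in>?J. A (i @ x # j) * D' j b)"
    using cut_factors_column[OF cut' _ b] by simp
  also have "\<dots> = (\<Sum>j\<in>?J. \<Sum>a<p. B i a * (C a (x # j) * D' j b))"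
  proof (rule sum.cong[OF refl])
    fix j assume "j \<in> ?J"
    then have "A (i @ x # j) = (\<Sum>a<p. B i a * C a (x # j))"
      by (intro cut_factors_entry[OF cut i] Cons_mem_multi_indices_drop[OF k x])
    then show "A (i @ x # j) * D' j b = (\<Sum>a<p. B i a * (C a (x # j) * D' j b))"
      by (simp add: sum_distrib_right mult.assoc)
  qed
  also have "\<dots> = (\<Sum>a<p. B i a * (\<Sum>j\<in>?J. C a (x # j) * D' j b))"
    by (subst sum.swap) (simp add: sum_distrib_left)
  finally show ?thesis .
qed

section \<open>Row vectors carried along a chain of matrices\<close>

lemma matrix_chain_carrier:
  fixes G :: "nat \<Rightarrow> complex mat"
  assumes "k \<le> d" and "\<And>l. l < d \<Longrightarrow> G (Suc l) \<in> carrier_mat (r l) (r (Suc l))"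
  shows "foldr (*) (map G [Suc k..<Suc d]) (1\<^sub>m (r d)) \<in> carrier_mat (r k) (r d)"
  using assms(1)
proof (induction k rule: inc_induct)
  case base
  show ?case by simp
next
  case (step k)
  have "[Suc k..<Suc d] = Suc k # [Suc (Suc k)..<Suc d]"
    using step.hyps by (simp add: upt_conv_Cons del: upt_Suc)
  then show ?case
    using mult_carrier_mat[OF assms(2)[OF \<open>k < d\<close>] step.IH] by (simp del: upt_Suc)
qed

text \<open>
  The chain is nested to the right, so the induction removes its first factor and goes down from
  the last cut.
\<close>

lemma row_times_matrix_chain:
  fixes G :: "nat \<Rightarrow> complex mat" and v :: "nat \<Rightarrow> nat \<Rightarrow> complex"
  assumes "k \<le> d" and G: "\<And>l. l < d \<Longrightarrow> G (Suc l) \<in> carrier_mat (r l) (r (Suc l))"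
    and v: "\<And>l b. l < d \<Longrightarrow> b < r (Suc l) \<Longrightarrow>
              v (Suc l) b = (\<Sum>a<r l. v l a * G (Suc l) $$ (a, b))"
    and c: "c < r d"
  shows "(\<Sum>a<r k. v k a * foldr (*) (map G [Suc k..<Suc d]) (1\<^sub>m (r d)) $$ (a, c)) = v d c"
  using assms(1)
proof (induction k rule: inc_induct)
  case base
  have "(\<Sum>a<r d. v d a * 1\<^sub>m (r d) $$ (a, c)) = (\<Sum>a<r d. if a = c then v d a else 0)"
    using c by (intro sum.cong) auto
  then show ?case
    using c by simp
next
  case (step k)
  let ?P = "foldr (*) (map G [Suc (Suc k)..<Suc d]) (1\<^sub>m (r d))"
  have P: "?P \<in> carrier_mat (r (Suc k)) (r d)"
    using matrix_chain_carrier[where k = "Suc k" and d = d and G = G and r = r] G step.hyps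
    by (simp del: upt_Suc)
  have chain: "foldr (*) (map G [Suc k..<Suc d]) (1\<^sub>m (r d)) = G (Suc k) * ?P"
    using step.hyps by (simp add: upt_conv_Cons del: upt_Suc)
  have "(G (Suc k) * ?P) $$ (a, c) = (\<Sum>b<r (Suc k). G (Suc k) $$ (a, b) * ?P $$ (b, c))"
    if "a < r k" for a
    using that c P G[OF \<open>k < d\<close>]
    by (simp add: scalar_prod_def atLeast0LessThan del: upt_Suc)
  then have "(\<Sum>a<r k. v k a * (G (Suc k) * ?P) $$ (a, c)) =
      (\<Sum>a<r k. \<Sum>b<r (Suc k). v k a * G (Suc k) $$ (a, b) * ?P $$ (b, c))"
    by (simp add: sum_distrib_left mult.assoc del: upt_Suc)
  also have "\<dots> = (\<Sum>b<r (Suc k). v (Suc k) b * ?P $$ (b, c))"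
    by (subst sum.swap) (simp add: v[OF \<open>k < d\<close>] sum_distrib_right del: upt_Suc)
  finally show ?case
    using step.IH chain by metis
qed

section \<open>The exact tensor train\<close>

theorem mainTheorem8:
  fixes d :: nat
    and ns :: "nat list"
    and A :: "nat list \<Rightarrow> complex"
    and r :: "nat \<Rightarrow> nat"
  assumes "d \<ge> 2"
    and "length ns = d"
    and "A \<in> tensors ns"
    and "frobenius_norm ns A = 1"
    and "r 0 = 1"
    and "r d = 1"
    and "\<And>k. k \<in> {1..d - 1} \<Longrightarrow> r k = mat_rank (unfolding_mat ns k A)"
  shows "\<exists>U :: nat \<Rightarrow> nat list \<Rightarrow> complex.
           (\<forall>k\<in>{1..d}. U k \<in> tensors [r (k - 1), ns ! (k - 1), r k]) \<and>
           A = tt_tensor ns r U \<and>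
           frobenius_norm ns (tt_tensor ns r U) = 1"
proof -
  have "\<exists>B C D. cut_factors ns A k (r k) B C D \<and> (k = 0 \<longrightarrow> B [] 0 = 1) \<and>
      (k = d \<longrightarrow> (\<forall>is. B is 0 = A is))" if "k \<le> d" for k
  proof -
    consider "k = 0" | "k = d" "k \<noteq> 0" | "k \<in> {1..d - 1}" "k \<noteq> 0" "k \<noteq> d"
      using \<open>k \<le> d\<close> \<open>d \<ge> 2\<close> by fastforce
    then show ?thesis
    proof cases
      case 1
      have "cut_factors ns A k (r k) (\<lambda>i a. 1) (\<lambda>a. A) (\<lambda>j a. cnj (A j))"
        using cut_factors_first[OF assms(4)] 1 \<open>r 0 = 1\<close> by simp
      then show ?thesis
        using 1 \<open>d \<ge> 2\<close>
        by (intro exI[of _ "\<lambda>i a. 1"] exI[of _ "\<lambda>a. A"] exI[of _ "\<lambda>j a. cnj (A j)"]) simp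
    next
      case 2
      have "cut_factors ns A k (r k) (\<lambda>i a. A i) (\<lambda>a j. 1) (\<lambda>j a. 1)"
        using cut_factors_last[of ns A] 2 \<open>r d = 1\<close> \<open>length ns = d\<close> by simp
      then show ?thesis
        using 2
        by (intro exI[of _ "\<lambda>i a. A i"] exI[of _ "\<lambda>a j. 1"] exI[of _ "\<lambda>j a. 1"]) simp
    next
      case 3
      show ?thesis
        using unfolding_factors[of ns A k] 3 assms(7)[OF 3(1)] by simp
    qed
  qed
  then obtain B C D where cut: "\<And>k. k \<le> d \<Longrightarrow> cut_factors ns A k (r k) (B k) (C k) (D k)"
    and first: "B 0 [] 0 = 1" and last: "\<And>is. B d is 0 = A is"
    by (metis le_refl zero_le)

  define core where "core k a x b =
    (\<Sum>j\<in>multi_indices (drop k ns). C (k - 1) a (x # j) * D k j b)" for k a x b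
  define U where "U k is =
    (if is \<in> multi_indices [r (k - 1), ns ! (k - 1), r k]
     then core k (is ! 0) (is ! 1) (is ! 2) else 0)" for k "is"
  have U_core: "U k [a, x, b] = core k a x b"
    if "a < r (k - 1)" "x < ns ! (k - 1)" "b < r k" for k a x b
    using that by (auto simp: U_def multi_indices_def nth_Cons' less_Suc_eq)

  have train: "tt_tensor ns r U is = A is" if "is": "is \<in> multi_indices ns" for "is"
  proof -
    define G where "G k = core_slice (r (k - 1)) (r k) (U k) (is ! (k - 1))" for k
    have G: "G (Suc l) \<in> carrier_mat (r l) (r (Suc l))" for l
      by (simp add: G_def core_slice_def)
    have len: "length is = d" and bound: "\<And>l. l < d \<Longrightarrow> is ! l < ns ! l"
      using "is" \<open>length ns = d\<close> by (auto simp: multi_indices_def)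
    have step: "B (Suc l) (take (Suc l) is) b = (\<Sum>a<r l. B l (take l is) a * G (Suc l) $$ (a, b))"
      if l: "l < d" and b: "b < r (Suc l)" for l b
    proof -
      have "B (Suc l) (take l is @ [is ! l]) b =
          (\<Sum>a<r l. B l (take l is) a * core (Suc l) a (is ! l) b)"
        using factors_extend_prefix[OF cut[OF less_imp_le[OF l]] cut[OF Suc_leI[OF l]]
            _ take_mem_multi_indices[OF "is"] bound[OF l] b] l \<open>length ns = d\<close>
        by (simp add: core_def)
      then show ?thesis
        using l b bound len by (simp add: take_Suc_conv_app_nth G_def core_slice_def U_core)
    qed
    have "(\<Sum>a<r 0. B 0 (take 0 is) a * foldr (*) (map G [Suc 0..<Suc d]) (1\<^sub>m (r d)) $$ (a, 0)) =
        B d (take d is) 0"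
      by (rule row_times_matrix_chain[where v = "\<lambda>k. B k (take k is)"])
        (use G step \<open>r d = 1\<close> in auto)
    then have "foldr (*) (map G [1..<Suc d]) (1\<^sub>m (r d)) $$ (0, 0) = A is"
      using first last len \<open>r 0 = 1\<close> by (simp del: upt_Suc)
    then show ?thesis
      using "is" \<open>length ns = d\<close> by (simp add: tt_tensor_def G_def[abs_def] del: upt_Suc)
  qed
  have "A = tt_tensor ns r U"
  proof
    fix "is"
    show "A is = tt_tensor ns r U is"
      using train[of "is"] \<open>A \<in> tensors ns\<close>
      by (cases "is \<in> multi_indices ns") (auto simp: tensors_def tt_tensor_def)
  qed
  moreover have "\<forall>k\<in>{1..d}. U k \<in> tensors [r (k - 1), ns ! (k - 1), r k]"
    by (auto simp: tensors_def U_def)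
  ultimately show ?thesis
    using assms(4) by metis
qed

end
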